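(* Let $A = (A_{pq})_{p,q=1}^2$ be a symmetric real $2 \times 2$ matrix. The following are equivalent. (1) For every integer $d \geq 2$ and every pair $\{k_1 < k_2\} \subseteq \{1,\dots,d\}$, there exists a totally positive Hankel $d \times d$ matrix $\widetilde{A}$ such that $\widetilde{A}_{k_p,k_q} = A_{pq}$ for $p, q = 1, 2$. (2) For every set $X \subseteq \mathbb{R}$ and every pair $\{x_1 < x_2\} \subseteq X$, there exists a totally positive continuous Hankel kernel $K$ on $X \times X$ such that $K(x_p,x_q) = A_{pq}$ for $p, q = 1, 2$. (3) The matrix $A$ is totally positive.
   Context: A real matrix is totally positive if all of its minors are positive. A $d \times d$ matrix is Hankel if its $(i,j)$ entry depends only on $i+j$. For $X \subseteq \mathbb{R}$, a Hankel kernel on $X \times X$ is a function of the form $K(x,y) = f(x+y)$ with $f : X+X \to \mathbb{R}$; it is totally positive if $\det(K(x_i,y_j))_{i,j=1}^n > 0$ for all $n \in \mathbb{N}$ and all $x_1 < \cdots < x_n$, $y_1 < \cdots < y_n$ in $X$. *)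

theory Defs
  imports Complex_Main
    "Jordan_Normal_Form.Determinant"
    "Jordan_Normal_Form.DL_Submatrix"
begin

text \<open>
  Matrices are those of \<^theory>\<open>Jordan_Normal_Form.Matrix\<close>: the dimension is a term, and rows and
  columns are indexed from 0. The Hankel property is not affected by the shift from indices
  starting at 1.
\<close>

text \<open>The empty minor (\<^term>\<open>I = {}\<close>) is included; it is 1, so it imposes no condition. The same holds
  for \<^term>\<open>n = (0::nat)\<close> in the definition for kernels.\<close>

definition totally_positive_mat :: "real mat \<Rightarrow> bool" where
  "totally_positive_mat A \<longleftrightarrow>
     (\<forall>I J. I \<subseteq> {..<dim_row A} \<and> J \<subseteq> {..<dim_col A} \<and> card I = card J \<longrightarrow>
        det (submatrix A I J) > 0)"

definition hankel_mat :: "'a mat \<Rightarrow> bool" where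
  "hankel_mat A \<longleftrightarrow> square_mat A \<and>
     (\<forall>i j i' j'. i < dim_row A \<and> j < dim_col A \<and> i' < dim_row A \<and> j' < dim_col A \<and>
        i + j = i' + j' \<longrightarrow> A $$ (i, j) = A $$ (i', j'))"

text \<open>A kernel on \<^term>\<open>X \<times> X\<close> is represented by a total function \<^term>\<open>K :: real \<Rightarrow> real \<Rightarrow> real\<close> of
  which only the values on \<^term>\<open>X \<times> X\<close> are constrained. Likewise, only the values of \<^term>\<open>f\<close> on
  the sumset of \<^term>\<open>X\<close> with itself matter.\<close>

definition hankel_kernel_on :: "real set \<Rightarrow> (real \<Rightarrow> real \<Rightarrow> real) \<Rightarrow> bool" where
  "hankel_kernel_on X K \<longleftrightarrow> (\<exists>f :: real \<Rightarrow> real. \<forall>x\<in>X. \<forall>y\<in>X. K x y = f (x + y))"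

definition continuous_kernel_on :: "real set \<Rightarrow> (real \<Rightarrow> real \<Rightarrow> real) \<Rightarrow> bool" where
  "continuous_kernel_on X K \<longleftrightarrow> continuous_on (X \<times> X) (\<lambda>(x, y). K x y)"

definition totally_positive_kernel_on :: "real set \<Rightarrow> (real \<Rightarrow> real \<Rightarrow> real) \<Rightarrow> bool" where
  "totally_positive_kernel_on X K \<longleftrightarrow>
     (\<forall>(n::nat) (x::nat \<Rightarrow> real) (y::nat \<Rightarrow> real).
        x ` {..<n} \<subseteq> X \<and> y ` {..<n} \<subseteq> X \<and>
        strict_mono_on {..<n} x \<and> strict_mono_on {..<n} y \<longrightarrow>
        det (mat n n (\<lambda>(i, j). K (x i) (y j))) > 0)"

end

theory Submission
  imports Defs
begin

text \<open>
  A totally positive symmetric matrix \<open>A\<close> has \<open>ln A\<^sub>1\<^sub>1 - 2 ln A\<^sub>1\<^sub>2 + ln A\<^sub>2\<^sub>2 > 0\<close>, so the quadratic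
  polynomial interpolating the logarithms of its entries at the equally spaced nodes
  \<open>2x\<^sub>1, x\<^sub>1 + x\<^sub>2, 2x\<^sub>2\<close> has leading coefficient \<open>c > 0\<close>. Its exponential \<open>f\<close> gives the Hankel kernel
  \<open>f(x + y)\<close>, which equals \<open>exp(2cxy)\<close> up to positive factors depending only on \<open>x\<close> or only on
  \<open>y\<close>, and is therefore totally positive. Restricting this kernel to the integers gives the matrix
  completions.

  That \<open>det(exp(x\<^sub>i y\<^sub>j)) > 0\<close> is shown by induction on the size: after normalising \<open>y\<^sub>1 = 0\<close> the first
  column is constant, so the determinant equals that of the consecutive row differences, and the mean
  value theorem, applied to one row after the other, turns these into rows
  \<open>z\<^sub>j exp(t\<^sub>i z\<^sub>j)\<close> with \<open>x\<^sub>i < t\<^sub>i < x\<^sub>i\<^sub>+\<^sub>1\<close>.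
\<close>

section \<open>Row and column operations on determinants\<close>

text \<open>Every term of the Leibniz expansion takes one entry from each row and each column, so
  the same product of scale factors comes out of all terms.\<close>

lemma det_scale_rows_cols:
  fixes r c :: "nat \<Rightarrow> 'a::comm_ring_1"
  shows "det (mat n n (\<lambda>(i, j). r i * c j * M i j))
    = (\<Prod>i<n. r i) * (\<Prod>j<n. c j) * det (mat n n (\<lambda>(i, j). M i j))"
proof -
  have "(\<Prod>i<n. r i * c (p i) * M i (p i)) = (\<Prod>i<n. r i) * (\<Prod>j<n. c j) * (\<Prod>i<n. M i (p i))"
    if "p permutes {..<n}" for p
    using prod.permute[OF that, of c] by (simp add: prod.distrib o_def)
  moreover have det: "det (mat n n (\<lambda>(i, j). N i j))
      = (\<Sum>p | p permutes {..<n}. signof p * (\<Prod>i<n. N i (p i)))" for N :: "nat \<Rightarrow> nat \<Rightarrow> 'a"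
  proof -
    have "p i < n" if "p permutes {..<n}" "i < n" for p i
      using permutes_in_image[OF that(1), of i] that(2) by simp
    then show ?thesis
      by (subst det_def'[where n = n]) (auto simp: atLeast0LessThan intro!: sum.cong prod.cong)
  qed
  ultimately show ?thesis
    unfolding det sum_distrib_left by (intro sum.cong) (simp_all add: mult_ac)
qed

text \<open>Subtracting from each row its predecessor is left multiplication by the unipotent matrix
  \<open>L\<close>. It turns the first column into (1, 0, ..., 0), and Laplace expansion along that
  column leaves a single cofactor.\<close>

lemma det_first_column_one:
  fixes M :: "nat \<Rightarrow> nat \<Rightarrow> 'a::idom"
  assumes "\<And>i. i \<le> n \<Longrightarrow> M i 0 = 1"
  shows "det (mat (Suc n) (Suc n) (\<lambda>(i, j). M i j))
    = det (mat n n (\<lambda>(i, j). M (Suc i) (Suc j) - M i (Suc j)))"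
proof -
  let ?N = "Suc n"
  let ?M = "mat ?N ?N (\<lambda>(i, j). M i j)"
  define L :: "'a mat" where
    "L = mat ?N ?N (\<lambda>(i, j). if i = j then 1 else if i = Suc j then - 1 else 0)"
  define D where "D = mat ?N ?N (\<lambda>(i, j). case i of 0 \<Rightarrow> M 0 j | Suc k \<Rightarrow> M (Suc k) j - M k j)"
  have L: "L \<in> carrier_mat ?N ?N" and D: "D \<in> carrier_mat ?N ?N"
    by (simp_all add: L_def D_def)
  have "L * ?M = D"
  proof (rule eq_matI)
    fix i j assume "i < dim_row D" "j < dim_col D"
    then have ij: "i < ?N" "j < ?N" by (simp_all add: D_def)
    have "(L * ?M) $$ (i, j)
      = (\<Sum>k<?N. (if k = i then M k j else 0) - (if Suc k = i then M k j else 0))"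
      using ij by (auto simp: L_def scalar_prod_def atLeast0LessThan intro!: sum.cong)
    also have "\<dots> = D $$ (i, j)"
    proof (cases i)
      case 0
      then show ?thesis using ij by (simp add: D_def sum_subtractf)
    next
      case (Suc k)
      then show ?thesis using ij by (simp add: D_def sum_subtractf)
    qed
    finally show "(L * ?M) $$ (i, j) = D $$ (i, j)" .
  qed (simp_all add: L_def D_def)
  moreover have "det L = 1"
  proof -
    have "diag_mat L = replicate ?N 1"
      by (rule nth_equalityI) (auto simp: diag_mat_def L_def simp del: upt_Suc replicate_Suc)
    moreover have "det L = prod_list (diag_mat L)"
      by (rule det_lower_triangular[OF _ L]) (auto simp: L_def)
    ultimately show ?thesis by (simp add: prod_list_replicate del: replicate_Suc)
  qed
  ultimately have "det ?M = det D"
    using det_mult[OF L, of ?M] by simp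
  also have "\<dots> = (\<Sum>i<?N. D $$ (i, 0) * cofactor D i 0)"
    by (rule laplace_expansion_column[OF D]) simp
  also have "\<dots> = (\<Sum>i<?N. if i = 0 then cofactor D 0 0 else 0)"
    by (rule sum.cong) (auto simp: D_def assms split: nat.split)
  also have "\<dots> = det (mat_delete D 0 0)"
    by (simp add: cofactor_def)
  also have "mat_delete D 0 0 = mat n n (\<lambda>(i, j). M (Suc i) (Suc j) - M i (Suc j))"
    by (rule eq_matI) (simp_all add: mat_delete_def D_def)
  finally show ?thesis .
qed

section \<open>A mean value theorem for determinants\<close>

text \<open>The cofactors along row \<open>m\<close> do not involve row \<open>m\<close>, so one
  choice of \<open>C\<close> serves all \<open>v\<close>.\<close>

lemma det_row_linear:
  fixes R :: "nat \<Rightarrow> nat \<Rightarrow> 'a::comm_ring_1"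
  assumes "m < n"
  obtains C where
    "\<And>v. det (mat n n (\<lambda>(i, j). if i = m then v j else R i j)) = (\<Sum>j<n. v j * C j)"
proof -
  define M where "M v = mat n n (\<lambda>(i, j). if i = m then v j else R i j)" for v
  have cof: "cofactor (M v) m j = cofactor (M (\<lambda>_. 0)) m j" if "j < n" for v j
  proof -
    have "mat_delete (M v) m j = mat_delete (M (\<lambda>_. 0)) m j"
      using that assms by (intro eq_matI) (auto simp: mat_delete_def M_def)
    then show ?thesis by (simp add: cofactor_def)
  qed
  show thesis
  proof (rule that)
    fix v
    have "det (M v) = (\<Sum>j<n. M v $$ (m, j) * cofactor (M v) m j)"
      by (rule laplace_expansion_row) (simp_all add: M_def assms)
    also have "\<dots> = (\<Sum>j<n. v j * cofactor (M (\<lambda>_. 0)) m j)"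
      by (intro sum.cong arg_cong2[where f = "(*)"] cof) (auto simp: M_def assms)
    finally show "det (mat n n (\<lambda>(i, j). if i = m then v j else R i j))
        = (\<Sum>j<n. v j * cofactor (M (\<lambda>_. 0)) m j)"
      by (simp add: M_def)
  qed
qed

text \<open>Applied entry by entry, the mean value theorem would give a different point in each
  column. Applied to the scalar function \<open>\<Sum>j<n. g t j * C j\<close>, it gives one
  \<open>t\<close> for the whole row.\<close>

lemma det_row_mvt:
  fixes g g' :: "real \<Rightarrow> nat \<Rightarrow> real" and R :: "nat \<Rightarrow> nat \<Rightarrow> real"
  assumes g: "\<And>t j. ((\<lambda>t. g t j) has_real_derivative g' t j) (at t)"
    and "m < n" and "a < b"
  shows "\<exists>t. a < t \<and> t < b \<and>
    det (mat n n (\<lambda>(i, j). if i = m then g b j - g a j else R i j))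
      = (b - a) * det (mat n n (\<lambda>(i, j). if i = m then g' t j else R i j))"
proof -
  obtain C where
    C: "\<And>v. det (mat n n (\<lambda>(i, j). if i = m then v j else R i j)) = (\<Sum>j<n. v j * C j)"
    using det_row_linear[OF \<open>m < n\<close>, of R] by blast
  have "((\<lambda>t. \<Sum>j<n. g t j * C j) has_real_derivative (\<Sum>j<n. g' t j * C j)) (at t)" for t
    by (intro DERIV_sum DERIV_cmult_right g)
  then obtain t where "a < t" "t < b"
    "(\<Sum>j<n. g b j * C j) - (\<Sum>j<n. g a j * C j) = (b - a) * (\<Sum>j<n. g' t j * C j)"
    using MVT2[OF \<open>a < b\<close>, of "\<lambda>t. \<Sum>j<n. g t j * C j" "\<lambda>t. \<Sum>j<n. g' t j * C j"] by blast
  then show ?thesis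
    by (auto simp: C left_diff_distrib sum_subtractf)
qed

lemma det_mvt:
  fixes g g' :: "real \<Rightarrow> nat \<Rightarrow> real" and x :: "nat \<Rightarrow> real"
  assumes g: "\<And>t j. ((\<lambda>t. g t j) has_real_derivative g' t j) (at t)"
    and x: "\<And>i. i < n \<Longrightarrow> x i < x (Suc i)"
  obtains t where "\<And>i. i < n \<Longrightarrow> x i < t i \<and> t i < x (Suc i)"
    "det (mat n n (\<lambda>(i, j). g (x (Suc i)) j - g (x i) j))
      = (\<Prod>i<n. x (Suc i) - x i) * det (mat n n (\<lambda>(i, j). g' (t i) j))"
proof -
  let ?d = "\<lambda>i j. g (x (Suc i)) j - g (x i) j"
  \<comment> \<open>Invariant: the first \<open>m\<close> rows have been replaced by derivatives,
    the others are still differences.\<close>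
  have "\<exists>t. (\<forall>i<m. x i < t i \<and> t i < x (Suc i)) \<and>
      det (mat n n (\<lambda>(i, j). ?d i j))
        = (\<Prod>i<m. x (Suc i) - x i) * det (mat n n (\<lambda>(i, j). if i < m then g' (t i) j else ?d i j))"
    if "m \<le> n" for m
    using that
  proof (induction m)
    case 0
    then show ?case by simp
  next
    case (Suc m)
    then obtain t where t: "\<forall>i<m. x i < t i \<and> t i < x (Suc i)"
      and det_t: "det (mat n n (\<lambda>(i, j). ?d i j))
        = (\<Prod>i<m. x (Suc i) - x i) * det (mat n n (\<lambda>(i, j). if i < m then g' (t i) j else ?d i j))"
      by auto
    let ?R = "\<lambda>i j. if i < m then g' (t i) j else ?d i j"
    have "m < n" using Suc.prems by simp
    then obtain s where s: "x m < s" "s < x (Suc m)"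
      and det_s: "det (mat n n (\<lambda>(i, j). if i = m then ?d m j else ?R i j))
        = (x (Suc m) - x m) * det (mat n n (\<lambda>(i, j). if i = m then g' s j else ?R i j))"
      using det_row_mvt[where g = g and g' = g' and R = ?R, OF g \<open>m < n\<close> x[OF \<open>m < n\<close>]]
      by (elim exE conjE)
    \<comment> \<open>Row \<open>m\<close> of \<open>?R\<close> is still a difference row, so the
      current matrix has the shape to which \<open>det_row_mvt\<close> applies.\<close>
    have "(\<lambda>(i, j). if i = m then ?d m j else ?R i j) = (\<lambda>(i, j). ?R i j)"
      by (auto simp: fun_eq_iff)
    moreover have "(\<lambda>(i, j). if i = m then g' s j else ?R i j)
        = (\<lambda>(i, j). if i < Suc m then g' ((t(m := s)) i) j else ?d i j)"
      by (auto simp: fun_eq_iff less_Suc_eq)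
    ultimately have "det (mat n n (\<lambda>(i, j). ?d i j)) = (\<Prod>i<Suc m. x (Suc i) - x i)
        * det (mat n n (\<lambda>(i, j). if i < Suc m then g' ((t(m := s)) i) j else ?d i j))"
      using det_t det_s by (simp only: prod.lessThan_Suc mult.assoc)
    moreover have "\<forall>i<Suc m. x i < (t(m := s)) i \<and> (t(m := s)) i < x (Suc i)"
      using t s by (simp add: less_Suc_eq)
    ultimately show ?case by blast
  qed
  from this[of n] obtain t where t: "\<forall>i<n. x i < t i \<and> t i < x (Suc i)"
    and det_t: "det (mat n n (\<lambda>(i, j). ?d i j))
      = (\<Prod>i<n. x (Suc i) - x i) * det (mat n n (\<lambda>(i, j). if i < n then g' (t i) j else ?d i j))"
    by auto
  have "mat n n (\<lambda>(i, j). if i < n then g' (t i) j else ?d i j) = mat n n (\<lambda>(i, j). g' (t i) j)"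
    by (rule eq_matI) auto
  with det_t t show thesis by (intro that) auto
qed

section \<open>Total positivity of exponential kernels\<close>

lemma det_exp_pos:
  fixes x y :: "nat \<Rightarrow> real"
  assumes "strict_mono_on {..<n} x" and "strict_mono_on {..<n} y"
  shows "det (mat n n (\<lambda>(i, j). exp (x i * y j))) > 0"
  using assms
proof (induction n arbitrary: x y)
  case 0
  then show ?case by simp
next
  case (Suc n)
  \<comment> \<open>The index shift matches the loss of the first column; the \<open>z j\<close> are
    positive because \<open>y\<close> increases.\<close>
  define z where "z j = y (Suc j) - y 0" for j
  define g where "g t j = exp (t * z j)" for t j
  define g' where "g' t j = z j * exp (t * z j)" for t j
  have x: "x i < x (Suc i)" if "i < n" for i
    using Suc.prems(1) that by (auto simp: strict_mono_on_def)
  have z_pos: "z j > 0" if "j < n" for j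
    using Suc.prems(2) that by (auto simp: strict_mono_on_def z_def)
  have "strict_mono_on {..<n} z"
    using Suc.prems(2) by (auto simp: strict_mono_on_def z_def)
  have "((\<lambda>t. g t j) has_real_derivative g' t j) (at t)" for t j
    unfolding g_def g'_def by (auto intro!: derivative_eq_intros)
  from det_mvt[where g = g and g' = g' and x = x and n = n, OF this x] obtain t
    where t: "\<And>i. i < n \<Longrightarrow> x i < t i \<and> t i < x (Suc i)"
      and det_t: "det (mat n n (\<lambda>(i, j). g (x (Suc i)) j - g (x i) j))
        = (\<Prod>i<n. x (Suc i) - x i) * det (mat n n (\<lambda>(i, j). g' (t i) j))"
    by blast
  \<comment> \<open>The points \<open>t i\<close> lie in consecutive disjoint intervals, so they
    increase and the induction hypothesis applies to them.\<close>
  have "strict_mono_on {..<n} t"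
  proof (rule strict_mono_onI)
    fix i j assume "i \<in> {..<n}" "j \<in> {..<n}" "i < j"
    then have "t i < x (Suc i)" "x j < t j" using t by auto
    moreover have "x (Suc i) \<le> x j"
      using strict_mono_on_leD[OF Suc.prems(1), of "Suc i" j] \<open>i < j\<close> \<open>j \<in> {..<n}\<close> by auto
    ultimately show "t i < t j" by linarith
  qed
  then have "det (mat n n (\<lambda>(i, j). exp (t i * z j))) > 0"
    using Suc.IH \<open>strict_mono_on {..<n} z\<close> by blast
  moreover have "(\<Prod>j<n. z j) > 0" "(\<Prod>i<n. x (Suc i) - x i) > 0"
    using z_pos x by (auto intro!: prod_pos)
  moreover have "det (mat n n (\<lambda>(i, j). g' (t i) j))
      = (\<Prod>j<n. z j) * det (mat n n (\<lambda>(i, j). exp (t i * z j)))"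
    using det_scale_rows_cols[of n "\<lambda>_. 1" z "\<lambda>i j. exp (t i * z j)"] by (simp add: g'_def)
  ultimately have "det (mat n n (\<lambda>(i, j). g (x (Suc i)) j - g (x i) j)) > 0"
    by (simp add: det_t)
  then have "det (mat (Suc n) (Suc n) (\<lambda>(i, j). exp (x i * (y j - y 0)))) > 0"
    using det_first_column_one[of n "\<lambda>i j. exp (x i * (y j - y 0))"] by (simp add: g_def z_def)
  \<comment> \<open>This undoes the normalisation: the shift of \<open>y\<close> by
    \<open>y 0\<close> costs a positive factor in each row.\<close>
  moreover have "det (mat (Suc n) (Suc n) (\<lambda>(i, j). exp (x i * y j)))
      = (\<Prod>i<Suc n. exp (x i * y 0)) * det (mat (Suc n) (Suc n) (\<lambda>(i, j). exp (x i * (y j - y 0))))"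
    using det_scale_rows_cols[of "Suc n" "\<lambda>i. exp (x i * y 0)" "\<lambda>_. 1" "\<lambda>i j. exp (x i * (y j - y 0))"]
    by (simp add: algebra_simps flip: exp_add)
  moreover have "(\<Prod>i<Suc n. exp (x i * y 0)) > 0"
    by (rule prod_pos) simp
  ultimately show ?case by (metis mult_pos_pos)
qed

lemma totally_positive_kernel_exp_quadratic:
  fixes a b c :: real
  assumes "c > 0"
  shows "totally_positive_kernel_on X (\<lambda>x y. exp (a + b * (x + y) + c * (x + y)\<^sup>2))"
  unfolding totally_positive_kernel_on_def
proof (intro allI impI, elim conjE)
  fix n and x y :: "nat \<Rightarrow> real"
  assume mono: "strict_mono_on {..<n} x" "strict_mono_on {..<n} y"
  define r where "r i = exp (a + b * x i + c * (x i)\<^sup>2)" for i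
  define s where "s j = exp (b * y j + c * (y j)\<^sup>2)" for j
  have "exp (a + b * (x i + y j) + c * (x i + y j)\<^sup>2) = r i * s j * exp (2 * c * x i * y j)" for i j
    by (simp add: r_def s_def power2_eq_square algebra_simps flip: exp_add)
  then have "det (mat n n (\<lambda>(i, j). exp (a + b * (x i + y j) + c * (x i + y j)\<^sup>2)))
      = (\<Prod>i<n. r i) * (\<Prod>j<n. s j) * det (mat n n (\<lambda>(i, j). exp (2 * c * x i * y j)))"
    using det_scale_rows_cols[of n r s "\<lambda>i j. exp (2 * c * x i * y j)"] by simp
  moreover have "(\<Prod>i<n. r i) > 0" "(\<Prod>j<n. s j) > 0"
    by (auto simp: r_def s_def intro!: prod_pos)
  \<comment> \<open>Since \<open>c > 0\<close>, the nodes \<open>2 * c * x i\<close> are again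
    increasing.\<close>
  moreover have "det (mat n n (\<lambda>(i, j). exp (2 * c * x i * y j))) > 0"
    using mono assms by (intro det_exp_pos) (auto simp: strict_mono_on_def)
  ultimately show "det (mat n n (\<lambda>(i, j). exp (a + b * (x i + y j) + c * (x i + y j)\<^sup>2))) > 0"
    by simp
qed

section \<open>Quadratic interpolation\<close>

lemma quadratic_interpolation_equidistant:
  fixes u v A B C :: real
  assumes "u < v" and "A + C > 2 * B"
  obtains a b c where "c > 0"
    "a + b * (u + u) + c * (u + u)\<^sup>2 = A"
    "a + b * (u + v) + c * (u + v)\<^sup>2 = B"
    "a + b * (v + v) + c * (v + v)\<^sup>2 = C"
proof -
  define h where "h = v - u"
  have h: "h > 0" "v = u + h" using assms by (simp_all add: h_def)
  \<comment> \<open>The nodes \<open>2 * u\<close>, \<open>2 * u + h\<close>,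
    \<open>2 * u + 2 * h\<close> have spacing \<open>h\<close>, so the second difference of the
    values is \<open>2 * c * h\<^sup>2\<close>. The first difference \<open>B - A\<close> then
    determines \<open>b\<close>, and the value at the first node determines
    \<open>a\<close>.\<close>
  define c where "c = (A + C - 2 * B) / (2 * h\<^sup>2)"
  define b where "b = (B - A) / h - c * (4 * u + h)"
  define a where "a = A - b * (u + u) - c * (u + u)\<^sup>2"
  have c: "c * h\<^sup>2 * 2 = A + C - 2 * B" using h by (simp add: c_def)
  have b: "b * h = B - A - c * (4 * u + h) * h" using h(1) by (simp add: b_def field_simps)
  show thesis
  proof
    show "c > 0" using assms h by (simp add: c_def)
    show "a + b * (u + u) + c * (u + u)\<^sup>2 = A" by (simp add: a_def)
    show "a + b * (u + v) + c * (u + v)\<^sup>2 = B"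
      using b by (simp add: a_def h(2) power2_eq_square algebra_simps)
    show "a + b * (v + v) + c * (v + v)\<^sup>2 = C"
      using b c by (simp add: a_def h(2) power2_eq_square algebra_simps)
  qed
qed

section \<open>Minors of matrices\<close>

text \<open>\<open>pick\<close> enumerates an index set in increasing order, so a minor of a sampled
  kernel is itself a kernel determinant at increasing nodes.\<close>

lemma totally_positive_mat_of_kernel:
  assumes K: "totally_positive_kernel_on X K"
    and x: "strict_mono_on {..<m} x" "x ` {..<m} \<subseteq> X"
    and y: "strict_mono_on {..<n} y" "y ` {..<n} \<subseteq> X"
  shows "totally_positive_mat (mat m n (\<lambda>(i, j). K (x i) (y j)))"
  unfolding totally_positive_mat_def
proof (intro allI impI, elim conjE)
  let ?M = "mat m n (\<lambda>(i, j). K (x i) (y j))"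
  fix I J assume I: "I \<subseteq> {..<dim_row ?M}" and J: "J \<subseteq> {..<dim_col ?M}" and IJ: "card I = card J"
  have pick_I: "pick I i < m" if "i < card I" for i
    using pick_in_set_le[OF that] I by auto
  have pick_J: "pick J j < n" if "j < card I" for j
    using pick_in_set_le[of j J] that J IJ by auto
  have "{i. i < m \<and> i \<in> I} = I" "{j. j < n \<and> j \<in> J} = J" using I J by auto
  then have "submatrix ?M I J
      = mat (card I) (card I) (\<lambda>(i, j). K ((x \<circ> pick I) i) ((y \<circ> pick J) j))"
    using IJ pick_I pick_J by (intro eq_matI) (auto simp: submatrix_def)
  moreover have "strict_mono_on {..<card I} (x \<circ> pick I)"
    using pick_I by (auto intro!: strict_mono_onI strict_mono_onD[OF x(1)] pick_mono_le)
  moreover have "strict_mono_on {..<card I} (y \<circ> pick J)"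
    using pick_J IJ by (auto intro!: strict_mono_onI strict_mono_onD[OF y(1)] pick_mono_le)
  moreover have "(x \<circ> pick I) ` {..<card I} \<subseteq> X" "(y \<circ> pick J) ` {..<card I} \<subseteq> X"
    using pick_I pick_J x(2) y(2) by auto
  ultimately show "det (submatrix ?M I J) > 0"
    using K unfolding totally_positive_kernel_on_def by presburger
qed

lemma totally_positive_mat_entry:
  assumes "totally_positive_mat A" and "i < dim_row A" and "j < dim_col A"
  shows "A $$ (i, j) > 0"
proof -
  have "{a. a < dim_row A \<and> a = i} = {i}" "{a. a < dim_col A \<and> a = j} = {j}"
    using assms by auto
  moreover have "pick {i} 0 = i" "pick {j} 0 = j"
    using pick_in_set_le[of 0 "{i}"] pick_in_set_le[of 0 "{j}"] by simp_all
  ultimately have "submatrix A {i} {j} = mat 1 1 (\<lambda>_. A $$ (i, j))"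
    by (intro eq_matI) (simp_all add: submatrix_def del: pick.simps)
  moreover have "det (submatrix A {i} {j}) > 0"
    using assms by (simp add: totally_positive_mat_def)
  ultimately show ?thesis by (simp add: det_single)
qed

lemma totally_positive_mat_det:
  assumes "totally_positive_mat A" and A: "A \<in> carrier_mat n n"
  shows "det A > 0"
proof -
  have pick: "pick {..<n} i = i" if "i < n" for i
    using pick_reduce_set[of i n UNIV] that by (simp add: pick_UNIV lessThan_def)
  have "submatrix A {..<n} {..<n} = A"
    using A by (intro eq_matI) (auto simp: submatrix_def pick)
  then show ?thesis
    using assms unfolding totally_positive_mat_def by (metis carrier_matD order_refl)
qed

lemma det_2x2:
  assumes A: "A \<in> carrier_mat 2 2"
  shows "det A = A $$ (0, 0) * A $$ (1, 1) - A $$ (0, 1) * (A $$ (1, 0) :: 'a::comm_ring_1)"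
proof -
  have "det (mat_delete A 0 0) = A $$ (1, 1)" "det (mat_delete A 0 1) = A $$ (1, 0)"
    using A by (auto simp: det_single mat_delete_def)
  then show ?thesis
    using laplace_expansion_row[OF A, of 0]
    by (simp add: cofactor_def numeral_2_eq_2)
qed

section \<open>The equivalence of the three conditions\<close>

theorem theorem4p10:
  fixes A :: "real mat"
  assumes "A \<in> carrier_mat 2 2"
    and "transpose_mat A = A"
  defines "cond1 \<equiv>
      (\<forall>d\<ge>2. \<forall>k :: nat \<Rightarrow> nat. k 0 < k 1 \<and> k 1 < d \<longrightarrow>
         (\<exists>B \<in> carrier_mat d d. totally_positive_mat B \<and> hankel_mat B \<and>
            (\<forall>p<2. \<forall>q<2. B $$ (k p, k q) = A $$ (p, q))))"
    and "cond2 \<equiv>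
      (\<forall>X :: real set. \<forall>x :: nat \<Rightarrow> real. x 0 \<in> X \<and> x 1 \<in> X \<and> x 0 < x 1 \<longrightarrow>
         (\<exists>K. totally_positive_kernel_on X K \<and> continuous_kernel_on X K \<and> hankel_kernel_on X K \<and>
            (\<forall>p<2. \<forall>q<2. K (x p) (x q) = A $$ (p, q))))"
    and "cond3 \<equiv> totally_positive_mat A"
  shows "(cond1 \<longleftrightarrow> cond2) \<and> (cond2 \<longleftrightarrow> cond3)"
proof -
  have A_entries: "A $$ (1, 0) = A $$ (0, 1)"
    using index_transpose_mat(1)[of 1 A 0] assms(1,2) by simp
  \<comment> \<open>A single construction for real nodes serves both the matrix and the kernel
    completions.\<close>
  have cond3_completion: "\<exists>a b c. c > 0 \<and>
      (\<forall>p<2. \<forall>q<2. exp (a + b * (x p + x q) + c * (x p + x q)\<^sup>2) = A $$ (p, q))"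
    if cond3 "x 0 < x 1" for x :: "nat \<Rightarrow> real"
  proof -
    have pos: "A $$ (0, 0) > 0" "A $$ (0, 1) > 0" "A $$ (1, 1) > 0"
      using \<open>cond3\<close> assms(1) by (auto simp: cond3_def intro!: totally_positive_mat_entry)
    have "A $$ (0, 0) * A $$ (1, 1) > A $$ (0, 1) * A $$ (0, 1)"
      using totally_positive_mat_det[OF _ assms(1)] \<open>cond3\<close> det_2x2[OF assms(1)] A_entries
      by (simp add: cond3_def)
    then have "ln (A $$ (0, 0) * A $$ (1, 1)) > ln (A $$ (0, 1) * A $$ (0, 1))"
      using pos by simp
    then have "ln (A $$ (0, 0)) + ln (A $$ (1, 1)) > 2 * ln (A $$ (0, 1))"
      using pos by (simp add: ln_mult)
    then obtain a b c where "c > 0"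
      and ln_eqs: "a + b * (x 0 + x 0) + c * (x 0 + x 0)\<^sup>2 = ln (A $$ (0, 0))"
      "a + b * (x 0 + x 1) + c * (x 0 + x 1)\<^sup>2 = ln (A $$ (0, 1))"
      "a + b * (x 1 + x 1) + c * (x 1 + x 1)\<^sup>2 = ln (A $$ (1, 1))"
      using quadratic_interpolation_equidistant[OF \<open>x 0 < x 1\<close>] by metis
    have "exp (a + b * (x p + x q) + c * (x p + x q)\<^sup>2) = A $$ (p, q)" if "p < 2" "q < 2" for p q
      \<comment> \<open>The entry (1, 0) is covered by the symmetry of \<open>A\<close>, matching
        that of \<open>x p + x q\<close>.\<close>
      using that pos ln_eqs A_entries by (auto simp: less_2_cases_iff add.commute[of "x (Suc 0)" "x 0"])
    with \<open>c > 0\<close> show ?thesis by blast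
  qed
  have "cond3" if asm: "cond1"
  proof -
    obtain B where "B \<in> carrier_mat 2 2" "totally_positive_mat B"
      and B: "\<forall>p<2. \<forall>q<2. B $$ (p, q) = A $$ (p, q)"
      \<comment> \<open>For \<open>d = 2\<close> the prescribed positions fill the matrix, so the
        completion is \<open>A\<close> itself.\<close>
      using asm[unfolded cond1_def, rule_format, of 2 "\<lambda>i. i"] by auto
    moreover from this have "B = A" using assms(1) by (intro eq_matI) auto
    ultimately show ?thesis by (simp add: cond3_def)
  qed
  moreover have "cond3" if asm: "cond2"
  proof -
    obtain K where K: "totally_positive_kernel_on UNIV K"
      and KA: "\<forall>p<2. \<forall>q<2. K (real p) (real q) = A $$ (p, q)"
      \<comment> \<open>Any admissible choice of nodes would do; here they are 0 and 1, and
        \<open>A\<close> is the kernel sampled there.\<close>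
      using asm[unfolded cond2_def, rule_format, of real UNIV] by auto
    have "A = mat 2 2 (\<lambda>(i, j). K (real i) (real j))"
      using assms(1) KA by (intro eq_matI) auto
    moreover have "strict_mono_on {..<2} real" by (simp add: strict_mono_on_def)
    ultimately show ?thesis
      using totally_positive_mat_of_kernel[OF K, of 2 real 2 real] by (simp add: cond3_def)
  qed
  moreover have "cond1" if asm: "cond3"
    unfolding cond1_def
  proof (intro allI impI, elim conjE)
    fix d :: nat and k :: "nat \<Rightarrow> nat"
    assume k: "k 0 < k 1" "k 1 < d"
    then obtain a b c where "c > 0" and
      eq: "\<forall>p<2. \<forall>q<2. exp (a + b * (real (k p) + real (k q)) + c * (real (k p) + real (k q))\<^sup>2)
        = A $$ (p, q)"
      using cond3_completion[OF asm, of "\<lambda>i. real (k i)"] by auto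
    \<comment> \<open>The kernel is sampled at 0, ..., \<open>d - 1\<close>, so the entries depend
      only on \<open>i + j\<close>.\<close>
    define B where
      "B = mat d d (\<lambda>(i, j). exp (a + b * (real i + real j) + c * (real i + real j)\<^sup>2))"
    have "totally_positive_mat B"
      unfolding B_def
      by (rule totally_positive_mat_of_kernel[OF totally_positive_kernel_exp_quadratic[OF \<open>c > 0\<close>, of UNIV]])
        (auto simp: strict_mono_on_def)
    moreover have "hankel_mat B"
      by (auto simp: hankel_mat_def B_def simp flip: of_nat_add)
    moreover have "\<forall>p<2. \<forall>q<2. B $$ (k p, k q) = A $$ (p, q)"
    proof -
      have "k p < d" if "p < 2" for p using that k by (auto simp: less_2_cases_iff)
      then show ?thesis using eq by (simp add: B_def)
    qed
    moreover have "B \<in> carrier_mat d d" by (simp add: B_def)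
    ultimately show "\<exists>B\<in>carrier_mat d d. totally_positive_mat B \<and> hankel_mat B \<and>
        (\<forall>p<2. \<forall>q<2. B $$ (k p, k q) = A $$ (p, q))"
      by blast
  qed
  moreover have "cond2" if asm: "cond3"
    unfolding cond2_def
  proof (intro allI impI, elim conjE)
    fix X :: "real set" and x :: "nat \<Rightarrow> real"
    assume "x 0 < x 1"
    then obtain a b c where "c > 0" and
      eq: "\<forall>p<2. \<forall>q<2. exp (a + b * (x p + x q) + c * (x p + x q)\<^sup>2) = A $$ (p, q)"
      using cond3_completion[OF asm] by blast
    \<comment> \<open>The kernel depends only on the two nodes and \<open>A\<close>; it is totally
      positive on all of the real line, hence on any \<open>X\<close>.\<close>
    define K where "K = (\<lambda>x y :: real. exp (a + b * (x + y) + c * (x + y)\<^sup>2))"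
    have "totally_positive_kernel_on X K"
      using totally_positive_kernel_exp_quadratic[OF \<open>c > 0\<close>] by (simp add: K_def)
    moreover have "continuous_kernel_on X K"
      unfolding continuous_kernel_on_def K_def split_def by (intro continuous_intros)
    moreover have "hankel_kernel_on X K"
      unfolding hankel_kernel_on_def K_def
      by (intro exI[of _ "\<lambda>s. exp (a + b * s + c * s\<^sup>2)"]) simp
    moreover have "\<forall>p<2. \<forall>q<2. K (x p) (x q) = A $$ (p, q)"
      using eq by (simp add: K_def)
    ultimately show "\<exists>K. totally_positive_kernel_on X K \<and> continuous_kernel_on X K \<and>
        hankel_kernel_on X K \<and> (\<forall>p<2. \<forall>q<2. K (x p) (x q) = A $$ (p, q))"
      by blast
  qed
  ultimately show ?thesis by blast
qed

end
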